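(* Let $n\ge 4$ and $k\ge 1$ be integers, and let $K_{n,n}$ be the complete bipartite graph with both parts of size $n$. Then \[\ddot{\gamma}_P^k(K_{n,n}) = \begin{cases} 2(k+1)- 4\left\lfloor \frac{k}{n+2} \right\rfloor & \text{if } k \equiv i \pmod{n+2} \text{ for some } 0\le i\le n-3,\\[4pt] k+n-1 +(n-2)\left\lfloor \frac{k}{n+2}\right\rfloor & \text{otherwise.} \end{cases}\]
   Context: Graphs are finite and simple. For a vertex $v$, $N[v]$ denotes its closed neighborhood. The power domination process on a graph $G$ with initial set $S\subseteq V(G)$: (1) set $B=\bigcup_{v\in S}N[v]$; (2) while there is $v\in B$ with exactly one neighbor $u\notin B$, add $u$ to $B$. A set $S$ is a power dominating set of $G$ if $B=V(G)$ when the process terminates. A multiset of vertices is called a power dominating set if its underlying set is one. For an integer $k\ge 0$, a $k$-robust power dominating set of $G$ is a finite multiset $S$ of elements of $V(G)$ with $|S|\ge k$ (counted with multiplicity) such that for every submultiset $F$ of $S$ with $|F|=k$, the multiset difference $S\setminus F$ is a power dominating set of $G$. $\ddot{\gamma}_P^k(G)$ denotes the minimum cardinality (with multiplicity) of a $k$-robust power dominating set of $G$. *)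

theory Defs
  imports
    "Graph_Theory.Kuratowski"
    "HOL-Library.Multiset"
    "HOL-Number_Theory.Cong"
begin

text \<open>
  Finite simple graphs are the symmetric loop-free digraphs without parallel arcs of
  \<^locale>\<open>graph\<close>; the complete bipartite graphs are given by the predicate
  \<^const>\<open>complete_bipartite_digraph\<close>.
\<close>

definition neighborhood :: "('a, 'b) pre_digraph \<Rightarrow> 'a \<Rightarrow> 'a set" where
  "neighborhood G v = {u. v \<rightarrow>\<^bsub>G\<^esub> u}"

definition closed_neighborhood :: "('a, 'b) pre_digraph \<Rightarrow> 'a \<Rightarrow> 'a set" where
  "closed_neighborhood G v = insert v (neighborhood G v)"

inductive zf_step :: "('a, 'b) pre_digraph \<Rightarrow> 'a set \<Rightarrow> 'a set \<Rightarrow> bool" for G where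
  "v \<in> B \<Longrightarrow> neighborhood G v - B = {u} \<Longrightarrow> zf_step G B (insert u B)"

definition pd_outcome :: "('a, 'b) pre_digraph \<Rightarrow> 'a set \<Rightarrow> 'a set \<Rightarrow> bool" where
  "pd_outcome G S B \<longleftrightarrow>
     (zf_step G)\<^sup>*\<^sup>* (\<Union>v\<in>S. closed_neighborhood G v) B \<and> (\<nexists>B'. zf_step G B B')"

text \<open>
  The process does not prescribe which vertex forces next. By \<open>pd_outcome_unique\<close> below the
  terminal set does not depend on these choices.
\<close>

definition power_dominating :: "('a, 'b) pre_digraph \<Rightarrow> 'a set \<Rightarrow> bool" where
  "power_dominating G S \<longleftrightarrow> S \<subseteq> verts G \<and> pd_outcome G S (verts G)"

definition robust_power_dominating ::
    "('a, 'b) pre_digraph \<Rightarrow> nat \<Rightarrow> 'a multiset \<Rightarrow> bool" where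
  "robust_power_dominating G k S \<longleftrightarrow>
     set_mset S \<subseteq> verts G \<and> k \<le> size S \<and>
     (\<forall>F. F \<subseteq># S \<and> size F = k \<longrightarrow> power_dominating G (set_mset (S - F)))"

text \<open>By \<open>robust_power_dominating_exists\<close> below the minimum is taken over a nonempty set
  whenever \<open>G\<close> has a vertex.\<close>

definition robust_pd_number :: "('a, 'b) pre_digraph \<Rightarrow> nat \<Rightarrow> nat" where
  "robust_pd_number G k = (LEAST m. \<exists>S. robust_power_dominating G k S \<and> size S = m)"

lemma zf_steps_subset:
  assumes "(zf_step G)\<^sup>*\<^sup>* B C" "B \<subseteq> D" "\<nexists>D'. zf_step G D D'"
  shows "C \<subseteq> D"
  using assms(1,2)
proof (induction rule: rtranclp_induct)
  case (step C1 C2)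
  then have C1: "C1 \<subseteq> D" by blast
  from step.hyps(2) obtain v u
    where v: "v \<in> C1" "neighborhood G v - C1 = {u}" "C2 = insert u C1"
    by (auto elim: zf_step.cases)
  have "u \<in> D"
  proof (rule ccontr)
    assume "u \<notin> D"
    then have "neighborhood G v - D = {u}" using v(2) C1 by blast
    then show False using assms(3) zf_step.intros[of v D G u] v(1) C1 by blast
  qed
  then show ?case using C1 v(3) by blast
qed

lemma zf_steps_increasing: "(zf_step G)\<^sup>*\<^sup>* B C \<Longrightarrow> B \<subseteq> C"
  by (induction rule: rtranclp_induct) (auto elim!: zf_step.cases)

lemma pd_outcome_unique:
  assumes "pd_outcome G S B" "pd_outcome G S C"
  shows "B = C"
  using assms zf_steps_subset zf_steps_increasing unfolding pd_outcome_def
  by (metis subset_antisym)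

lemma (in fin_digraph) robust_power_dominating_exists:
  assumes "verts G \<noteq> {}"
  shows "\<exists>S. robust_power_dominating G k S"
proof -
  define S where "S = repeat_mset (Suc k) (mset_set (verts G))"
  have "card (verts G) \<ge> 1" using assms by (simp add: Suc_le_eq card_gt_0_iff)
  then have sz: "k \<le> size S"
    using mult_le_mono[of k "Suc k" 1 "card (verts G)"] by (simp add: S_def)
  have sub: "set_mset S \<subseteq> verts G"
  proof
    fix x assume "x \<in># S"
    then have "count S x > 0" by simp
    then show "x \<in> verts G" by (cases "x \<in> verts G") (simp_all add: S_def)
  qed
  have "power_dominating G (set_mset (S - F))" if "F \<subseteq># S" "size F = k" for F
  proof -
    have "count F v \<le> k" for v using that(2) count_le_size[of F v] by simp
    then have "v \<in># S - F" if "v \<in> verts G" for v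
      using that by (simp add: S_def in_diff_count less_Suc_eq_le)
    moreover have "set_mset (S - F) \<subseteq> verts G"
      using sub set_mset_mono[OF diff_subset_eq_self[of S F]] by (rule subset_trans[rotated])
    ultimately have eq: "set_mset (S - F) = verts G" by blast
    have "(\<Union>v\<in>verts G. closed_neighborhood G v) = verts G"
      by (auto simp: closed_neighborhood_def neighborhood_def dest: adj_in_verts)
    moreover have "\<not> zf_step G (verts G) B'" for B'
    proof
      assume "zf_step G (verts G) B'"
      then obtain v u where "neighborhood G v - verts G = {u}" by cases
      moreover have "neighborhood G v \<subseteq> verts G"
        by (auto simp: neighborhood_def intro: adj_in_verts(2))
      ultimately show False by blast
    qed
    ultimately show ?thesis by (simp add: eq power_dominating_def pd_outcome_def)
  qed
  then show ?thesis using sz sub unfolding robust_power_dominating_def by blast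
qed

end

theory Submission
  imports Defs
begin

text \<open>
  A set power dominates \<open>K\<^bsub>n,n\<^esub>\<close> iff it meets both sides or contains at least \<open>n - 1\<close> vertices of
  one side. So a multiset with \<open>a\<close> vertices on one side and \<open>b\<close> on the other is destroyed most
  cheaply by deleting one side and the two rarest vertices of the other side. Distributing the
  \<open>a\<close> vertices evenly maximises the total multiplicity of the two rarest ones, the maximum being
  \<open>\<lfloor>a / n\<rfloor> + \<lfloor>(a + 1) / n\<rfloor>\<close>. It remains to minimise \<open>a + b\<close> subject to two inequalities.
\<close>

section \<open>Power domination in balanced complete bipartite graphs\<close>

text \<open>The sides are fixed as parameters, so facts need proof only for \<open>U\<close>;
  interpreting the locale with \<open>U\<close> and \<open>V\<close> exchanged (\<open>swap\<close>)
  gives them for \<open>V\<close>.\<close>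

locale balanced_bipartite =
  fixes G :: "('a, 'b) pre_digraph" and U V :: "'a set" and n :: nat
  assumes verts_eq: "verts G = U \<union> V"
    and disjoint: "U \<inter> V = {}"
    and card_U: "card U = n"
    and card_V: "card V = n"
    and arcs_eq: "arcs_ends G = U \<times> V \<union> V \<times> U"
    and n_ge_2: "n \<ge> 2"
begin

lemma swap: "balanced_bipartite G V U n"
  using verts_eq disjoint card_U card_V arcs_eq n_ge_2 by unfold_locales auto

lemma finite_U: "finite U"
  using card_U n_ge_2 by (metis card.infinite not_numeral_le_zero)

lemma finite_V: "finite V"
  using card_V n_ge_2 by (metis card.infinite not_numeral_le_zero)

lemma nonempty_V: "V \<noteq> {}"
  using card_V n_ge_2 by auto

lemma neighborhood_U: "v \<in> U \<Longrightarrow> neighborhood G v = V"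
  and neighborhood_V: "v \<in> V \<Longrightarrow> neighborhood G v = U"
  using disjoint by (auto simp: neighborhood_def arcs_eq)

lemma no_step_verts: "\<not> zf_step G (verts G) B"
proof
  assume "zf_step G (verts G) B"
  then obtain v u where "v \<in> verts G" "neighborhood G v - verts G = {u}" by cases
  then show False using neighborhood_U neighborhood_V verts_eq by blast
qed

lemma closed_neighborhoods_one_side:
  assumes "S \<subseteq> U" "S \<noteq> {}"
  shows "(\<Union>v\<in>S. closed_neighborhood G v) = S \<union> V"
  using assms neighborhood_U by (auto simp: closed_neighborhood_def)

lemma power_dominating_both_sides:
  assumes "S \<subseteq> verts G" "S \<inter> U \<noteq> {}" "S \<inter> V \<noteq> {}"
  shows "power_dominating G S"
proof -
  obtain u v where "u \<in> S \<inter> U" "v \<in> S \<inter> V" using assms by blast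
  then have "verts G \<subseteq> (\<Union>v\<in>S. closed_neighborhood G v)"
    using neighborhood_U neighborhood_V by (auto simp: verts_eq closed_neighborhood_def)
  moreover have "(\<Union>v\<in>S. closed_neighborhood G v) \<subseteq> verts G"
    using assms(1) neighborhood_U neighborhood_V
    by (fastforce simp: verts_eq closed_neighborhood_def)
  ultimately have "(\<Union>v\<in>S. closed_neighborhood G v) = verts G" by (rule subset_antisym[rotated])
  then show ?thesis
    using assms(1) no_step_verts by (simp add: power_dominating_def pd_outcome_def)
qed

text \<open>A nonempty \<open>S\<close> starts the process at \<open>S \<union> V\<close>. Every
  vertex of \<open>V\<close> then has exactly \<open>U - S\<close> as its uncovered neighbors, so a
  force is possible only if one vertex of \<open>U\<close> is missing.\<close>

lemma power_dominating_one_side: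
  assumes "S \<subseteq> U"
  shows "power_dominating G S \<longleftrightarrow> n - 1 \<le> card S"
proof
  have fin: "finite S" using assms finite_U finite_subset by blast
  assume large: "n - 1 \<le> card S"
  then have "S \<noteq> {}" using n_ge_2 by auto
  note init = closed_neighborhoods_one_side[OF assms this]
  have "(zf_step G)\<^sup>*\<^sup>* (S \<union> V) (verts G)"
  proof (cases "S = U")
    case True
    then show ?thesis by (simp add: verts_eq)
  next
    case False
    then have "card (U - S) \<noteq> 0" using finite_U assms by auto
    moreover have "card (U - S) \<le> 1" using large assms fin card_U by (simp add: card_Diff_subset)
    ultimately have "card (U - S) = 1" by linarith
    then obtain u where u: "U - S = {u}" by (auto simp: card_1_singleton_iff)
    obtain v where v: "v \<in> V" using nonempty_V by blast
    have "neighborhood G v - (S \<union> V) = {u}"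
      using u neighborhood_V[OF v] disjoint by auto
    then have "zf_step G (S \<union> V) (insert u (S \<union> V))"
      using v by (intro zf_step.intros) auto
    moreover have "insert u (S \<union> V) = verts G" using u assms verts_eq by auto
    ultimately show ?thesis by auto
  qed
  then show "power_dominating G S"
    using assms no_step_verts init by (auto simp: power_dominating_def pd_outcome_def verts_eq)
next
  assume pd: "power_dominating G S"
  show "n - 1 \<le> card S"
  proof (rule ccontr)
    have fin: "finite S" using assms finite_U finite_subset by blast
    assume small: "\<not> n - 1 \<le> card S"
    then have card: "card (U - S) \<ge> 2" using assms fin card_U by (simp add: card_Diff_subset)
    let ?B = "\<Union>v\<in>S. closed_neighborhood G v"
    \<comment> \<open>For empty \<open>S\<close> the initial set is empty, not \<open>V\<close>;
      hence only an inclusion in general.\<close>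
    have B: "?B \<subseteq> S \<union> V" "S \<noteq> {} \<Longrightarrow> ?B = S \<union> V"
      using closed_neighborhoods_one_side[OF assms] by (cases "S = {}"; auto)+
    have "\<not> zf_step G ?B B'" for B'
    proof
      assume "zf_step G ?B B'"
      then obtain v u where vu: "v \<in> ?B" "neighborhood G v - ?B = {u}" by cases
      then have eq: "?B = S \<union> V" using B(2) by blast
      show False
      proof (cases "v \<in> U")
        case True
        then show False using vu(2) neighborhood_U eq by auto
      next
        case False
        then have "v \<in> V" using vu(1) eq assms by blast
        then have "U - S = {u}" using vu(2) neighborhood_V eq disjoint by auto
        then show False using card by simp
      qed
    qed
    moreover have "(zf_step G)\<^sup>*\<^sup>* ?B (verts G)"
      using pd by (simp add: power_dominating_def pd_outcome_def)
    \<comment> \<open>With no step leaving \<open>?B\<close>, the only reachable set is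
      \<open>?B\<close> itself.\<close>
    ultimately have "?B = verts G" by (metis converse_rtranclpE)
    then have "U - S = {}" using B(1) verts_eq disjoint by blast
    then show False using card by (metis card.empty not_numeral_le_zero)
  qed
qed

lemma not_power_dominatingI:
  assumes "S \<inter> V = {}" "x \<in> U - S" "y \<in> U - S" "x \<noteq> y"
  shows "\<not> power_dominating G S"
proof
  assume pd: "power_dominating G S"
  then have sub: "S \<subseteq> U" using assms(1) by (auto simp: power_dominating_def verts_eq)
  then have "n - 1 \<le> card S" using pd power_dominating_one_side by blast
  moreover have "card S \<le> card (U - {x, y})"
    using sub assms finite_U by (intro card_mono) auto
  moreover have "card (U - {x, y}) = n - 2"
    using assms finite_U card_U by (simp add: card_Diff_subset)
  ultimately show False using n_ge_2 by linarith
qed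

lemma two_missing:
  assumes "S \<subseteq> verts G" "S \<inter> V = {}" "\<not> power_dominating G S"
  obtains x y where "x \<in> U - S" "y \<in> U - S" "x \<noteq> y"
proof -
  have sub: "S \<subseteq> U" using assms verts_eq by blast
  then have "card (U - S) = n - card S"
    using card_U finite_U finite_subset by (metis card_Diff_subset)
  then have "2 \<le> card (U - S)"
    using assms(3) power_dominating_one_side[OF sub] by linarith
  then obtain T where "T \<subseteq> U - S" "card T = 2" by (meson obtain_subset_with_card_n)
  then show thesis using that by (auto simp: card_2_iff)
qed

end

section \<open>Robustness in terms of multiplicities\<close>

lemma size_filter_mset_eq_sum_count:
  assumes "finite A"
  shows "size {#z \<in># M. z \<in> A#} = sum (count M) A"
proof (induction M)
  case (add x M)
  have "sum (count (add_mset x M)) A = sum (count M) A + (\<Sum>z\<in>A. if z = x then 1 else 0)"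
    by (subst sum.distrib[symmetric]) (intro sum.cong, auto)
  then show ?case using add assms by simp
qed simp

text \<open>Robustness speaks of deletions of size exactly \<open>k\<close>; a cheaper destructive
  deletion \<open>A\<close> is padded here to that size.\<close>

lemma submultiset_between:
  assumes "A \<subseteq># M" "size A \<le> k" "k \<le> size M"
  obtains F where "A \<subseteq># F" "F \<subseteq># M" "size F = k"
proof -
  obtain xs where xs: "mset xs = M - A" using ex_mset by blast
  define F where "F = A + mset (take (k - size A) xs)"
  have "F + mset (drop (k - size A) xs) = A + mset xs"
    unfolding F_def by (metis add.assoc append_take_drop_id mset_append)
  also have "\<dots> = M" using xs assms(1) by simp
  finally have "F \<subseteq># M" by (metis mset_subset_eq_add_left)
  moreover have "length xs = size M - size A"
    using xs assms(1) by (metis size_Diff_submset size_mset)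
  then have "size F = k" using assms(2,3) by (simp add: F_def)
  moreover have "A \<subseteq># F" by (simp add: F_def)
  ultimately show thesis using that by blast
qed

context balanced_bipartite
begin

lemma size_eq_sums:
  assumes "set_mset S \<subseteq> verts G"
  shows "size S = sum (count S) U + sum (count S) V"
proof -
  have "{#z \<in># S. z \<in> U \<union> V#} = S" using assms by (auto simp: filter_mset_eq_conv verts_eq)
  then have "size S = sum (count S) (U \<union> V)"
    using size_filter_mset_eq_sum_count[of "U \<union> V" S] finite_U finite_V by simp
  then show ?thesis using disjoint finite_U finite_V by (simp add: sum.union_disjoint)
qed

lemma size_filter_side_and_two:
  assumes "x \<in> U" "y \<in> U" "x \<noteq> y"
  shows "size {#z \<in># S. z \<in> V \<union> {x, y}#} = sum (count S) V + count S x + count S y"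
proof -
  have "V \<inter> {x, y} = {}" using assms disjoint by blast
  then have "sum (count S) (V \<union> {x, y}) = sum (count S) V + sum (count S) {x, y}"
    using finite_V by (intro sum.union_disjoint) auto
  then show ?thesis
    using assms finite_V by (subst size_filter_mset_eq_sum_count) auto
qed

text \<open>Deleting all copies of the vertices in \<open>V\<close>, of \<open>x\<close> and of
  \<open>y\<close> leaves a set that does not power dominate, so this deletion must cost more than
  \<open>k\<close>.\<close>

lemma robust_imp_multiplicities:
  assumes "robust_power_dominating G k S" "x \<in> U" "y \<in> U" "x \<noteq> y"
  shows "k < sum (count S) V + count S x + count S y"
proof (rule ccontr)
  let ?A = "{#z \<in># S. z \<in> V \<union> {x, y}#}"
  assume "\<not> ?thesis"
  then have "size ?A \<le> k" using size_filter_side_and_two[OF assms(2-4)] by simp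
  moreover have "k \<le> size S" using assms(1) by (simp add: robust_power_dominating_def)
  ultimately obtain F where F: "?A \<subseteq># F" "F \<subseteq># S" "size F = k"
    using submultiset_between[of ?A S k] multiset_filter_subset by blast
  have "z \<notin># S - F" if "z \<in> V \<union> {x, y}" for z
    using mset_subset_eq_count[OF F(1), of z] that by (auto simp: in_diff_count)
  then have "\<not> power_dominating G (set_mset (S - F))"
    using assms(2-4) by (intro not_power_dominatingI[of _ x y]) auto
  then show False using assms(1) F by (simp add: robust_power_dominating_def)
qed

text \<open>If \<open>F\<close> removes all of \<open>V\<close> and the rest fails to power
  dominate, two vertices of \<open>U\<close> are missing as well. Then \<open>F\<close> contains all
  their copies, which makes it too large.\<close>

lemma power_dominating_after_deletion:
  assumes "set_mset S \<subseteq> verts G" "F \<subseteq># S"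
    and "\<And>x y. x \<in> U \<Longrightarrow> y \<in> U \<Longrightarrow> x \<noteq> y \<Longrightarrow> size F < sum (count S) V + count S x + count S y"
    and "set_mset (S - F) \<inter> V = {}"
  shows "power_dominating G (set_mset (S - F))"
proof (rule ccontr)
  assume "\<not> ?thesis"
  moreover have "set_mset (S - F) \<subseteq> verts G" using assms(1) by (meson in_diffD subset_iff)
  ultimately obtain x y where xy: "x \<in> U - set_mset (S - F)" "y \<in> U - set_mset (S - F)" "x \<noteq> y"
    using two_missing assms(4) by blast
  have "count S z \<le> count F z" if "z \<in> V \<union> {x, y}" for z
  proof -
    have "z \<notin># S - F" using that xy assms(4) by blast
    then show ?thesis by (simp add: in_diff_count)
  qed
  then have "{#z \<in># S. z \<in> V \<union> {x, y}#} \<subseteq># F"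
    by (intro mset_subset_eqI) simp
  then have "size {#z \<in># S. z \<in> V \<union> {x, y}#} \<le> size F" by (rule size_mset_mono)
  then show False using assms(3)[of x y] xy size_filter_side_and_two[of x y S] by simp
qed

lemma robust_power_dominatingI:
  assumes "set_mset S \<subseteq> verts G"
    and U: "\<And>x y. x \<in> U \<Longrightarrow> y \<in> U \<Longrightarrow> x \<noteq> y \<Longrightarrow> k < sum (count S) V + count S x + count S y"
    and V: "\<And>x y. x \<in> V \<Longrightarrow> y \<in> V \<Longrightarrow> x \<noteq> y \<Longrightarrow> k < sum (count S) U + count S x + count S y"
  shows "robust_power_dominating G k S"
proof -
  interpret swap: balanced_bipartite G V U n by (rule swap)
  have "k \<le> size S"
  proof -
    \<comment> \<open>Any one pair suffices: its inequality exhibits a submultiset of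
      \<open>S\<close> with more than \<open>k\<close> elements.\<close>
    obtain T where "T \<subseteq> U" "card T = 2" using obtain_subset_with_card_n n_ge_2 card_U by metis
    then obtain x y where xy: "x \<in> U" "y \<in> U" "x \<noteq> y" by (auto simp: card_2_iff)
    have "size {#z \<in># S. z \<in> V \<union> {x, y}#} \<le> size S" by (rule size_filter_mset_lesseq)
    then show ?thesis using U[OF xy] size_filter_side_and_two[OF xy] by (metis less_le_trans less_imp_le)
  qed
  moreover have "power_dominating G (set_mset (S - F))" if F: "F \<subseteq># S" "size F = k" for F
  proof -
    have sub: "set_mset (S - F) \<subseteq> verts G" using assms(1) by (meson in_diffD subset_iff)
    consider "set_mset (S - F) \<inter> V = {}" | "set_mset (S - F) \<inter> U = {}"
      | "set_mset (S - F) \<inter> U \<noteq> {}" "set_mset (S - F) \<inter> V \<noteq> {}" by blast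
    then show ?thesis
    proof cases
      case 1
      then show ?thesis using power_dominating_after_deletion[OF assms(1) F(1)] U F(2) by blast
    next
      case 2
      then show ?thesis using swap.power_dominating_after_deletion[OF assms(1) F(1)] V F(2) by blast
    next
      case 3
      then show ?thesis using power_dominating_both_sides[OF sub] by blast
    qed
  qed
  ultimately show ?thesis using assms(1) by (simp add: robust_power_dominating_def)
qed

end

section \<open>The two smallest values of a function with given sum\<close>

text \<open>The summands are the smallest and second smallest value when \<open>a\<close> units are
  spread evenly over \<open>n\<close> places; they differ only when all places but one hold an extra
  unit.\<close>

definition max_two_smallest :: "nat \<Rightarrow> nat \<Rightarrow> nat" where
  "max_two_smallest n a = a div n + (a + 1) div n"

lemma max_two_smallest_mono: "a \<le> b \<Longrightarrow> max_two_smallest n a \<le> max_two_smallest n b"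
  by (simp add: max_two_smallest_def add_mono div_le_mono)

lemma max_two_smallest_eq:
  assumes "r < n"
  shows "max_two_smallest n (q * n + r) = 2 * q + (if r = n - 1 then 1 else 0)"
proof (cases "r = n - 1")
  case True
  then have "q * n + r + 1 = (q + 1) * n" using assms by simp
  then have d: "(q * n + r + 1) div n = q + 1" using assms by (metis nonzero_mult_div_cancel_right not_less_zero)
  have "(q * n + r) div n = q" using assms by simp
  then show ?thesis unfolding max_two_smallest_def d using True by simp
next
  case False
  then have "r + 1 < n" using assms by simp
  then have "(q * n + (r + 1)) div n = q" by (subst div_mult_self3) auto
  then show ?thesis using assms False by (simp add: max_two_smallest_def)
qed

text \<open>One more unit replaces the quotient of \<open>a + s\<close> by that of
  \<open>a + s + 2\<close>, which is larger by at most 1 since \<open>n\<close> is at least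
  2.\<close>

lemma max_two_smallest_add_le:
  assumes "n \<ge> 2"
  shows "max_two_smallest n (a + s) \<le> max_two_smallest n a + s"
proof (induction s)
  case (Suc s)
  have "(a + s + 2) div n \<le> (a + s + n) div n" using assms by (intro div_le_mono) simp
  then have "max_two_smallest n (a + s + 1) \<le> max_two_smallest n (a + s) + 1"
    using assms by (simp add: max_two_smallest_def)
  then show ?case using Suc by simp
qed simp

text \<open>Take \<open>x\<close> minimal and \<open>y\<close> minimal among the others: then
  \<open>n - 1\<close> of the values are at least \<open>c y\<close>, which bounds the total from
  below.\<close>

lemma exists_two_small_values:
  fixes c :: "'a \<Rightarrow> nat"
  assumes "card A = n" "n \<ge> 2"
  obtains x y where "x \<in> A" "y \<in> A" "x \<noteq> y" "c x + c y \<le> max_two_smallest n (sum c A)"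
proof -
  have fin: "finite A" using assms by (metis card.infinite not_numeral_le_zero)
  have "A \<noteq> {}" using assms by auto
  then obtain x where x: "x \<in> A" "\<And>z. z \<in> A \<Longrightarrow> c x \<le> c z"
    using fin by (metis arg_min_if_finite(1) arg_min_least)
  have card': "card (A - {x}) = n - 1" using x(1) assms fin by simp
  then have "A - {x} \<noteq> {}" using assms(2) by (intro notI) simp
  then obtain y where y: "y \<in> A - {x}" "\<And>z. z \<in> A - {x} \<Longrightarrow> c y \<le> c z"
    using fin by (metis arg_min_if_finite(1) arg_min_least finite_Diff)
  define q r where "q = sum c A div n" and "r = sum c A mod n"
  have r: "r < n" and a: "sum c A = q * n + r" using assms(2) by (auto simp: q_def r_def)
  have "(n - 1) * c y \<le> sum c (A - {x})"
    using sum_bounded_below[of "A - {x}" "c y" c] y(2) card' by simp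
  then have lower: "c x + (n - 1) * c y \<le> q * n + r" using a x(1) fin by (simp add: sum.remove)
  have "c x + c y \<le> max_two_smallest n (sum c A)"
  proof (cases "c y \<le> q")
    case True
    then have "c x + c y \<le> 2 * q" using x(2)[of y] y(1) by simp
    then show ?thesis by (simp add: a max_two_smallest_eq[OF r])
  next
    case False
    then obtain e where e: "c y = q + 1 + e" using less_eqE by (metis Suc_eq_plus1 not_less_eq_eq)
    obtain m where m: "n = m + 2" using assms(2) by (metis add.commute le_Suc_ex)
    \<comment> \<open>Subtracting \<open>m = n - 2\<close> copies of \<open>c y\<close>, each at
      least \<open>q + 1\<close>, from \<open>lower\<close>. As \<open>r\<close> is at most
      \<open>m + 1\<close>, the excess over \<open>2 * q\<close> is at most 1, and 1 only for
      \<open>r = n - 1\<close>.\<close>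
    have "c x + c y + m \<le> 2 * q + r"
      using lower unfolding e m by (simp add: algebra_simps)
    then have "c x + c y \<le> 2 * q + (if r = n - 1 then 1 else 0)" using r m by auto
    then show ?thesis by (simp only: a max_two_smallest_eq[OF r])
  qed
  then show thesis using that x(1) y(1) by blast
qed

lemma exists_balanced_distribution:
  assumes "card A = n" "n \<ge> 2"
  obtains c :: "'a \<Rightarrow> nat" where "sum c A = a"
    "\<And>x y. x \<in> A \<Longrightarrow> y \<in> A \<Longrightarrow> x \<noteq> y \<Longrightarrow> max_two_smallest n a \<le> c x + c y"
proof -
  have fin: "finite A" using assms by (metis card.infinite not_numeral_le_zero)
  have "A \<noteq> {}" using assms by auto
  then obtain x0 where x0: "x0 \<in> A" by blast
  define q r where "q = a div n" and "r = a mod n"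
  have r: "r < n" and a: "a = q * n + r" using assms(2) by (auto simp: q_def r_def)
  \<comment> \<open>Only the remainder \<open>n - 1\<close> can raise the bound above
    \<open>2 * q\<close>. It is spread over all elements except \<open>x0\<close>, so that any pair
    contains a raised one; a smaller remainder is simply placed on \<open>x0\<close>.\<close>
  define c where
    "c x = q + (if r = n - 1 then (if x = x0 then 0 else 1) else (if x = x0 then r else 0))" for x
  have card': "card (A - {x0}) = n - 1" using x0 assms fin by simp
  have "sum c (A - {x0}) = (n - 1) * (q + (if r = n - 1 then 1 else 0))"
  proof -
    have "sum c (A - {x0}) = (\<Sum>x\<in>A - {x0}. q + (if r = n - 1 then 1 else 0))"
      by (intro sum.cong) (auto simp: c_def)
    then show ?thesis using card' by simp
  qed
  then have "sum c A = c x0 + (n - 1) * (q + (if r = n - 1 then 1 else 0))"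
    using x0 fin by (simp add: sum.remove)
  moreover obtain m where m: "n = m + 1" using assms(2) by (metis add.commute le_Suc_ex add_leD1 one_add_one)
  ultimately have "sum c A = a" unfolding a c_def m by (simp add: algebra_simps)
  moreover have "max_two_smallest n a \<le> c x + c y" if "x \<noteq> y" for x y
    using that by (auto simp: a max_two_smallest_eq[OF r] c_def)
  ultimately show thesis using that by blast
qed

section \<open>Reduction to a condition on the two side totals\<close>

context balanced_bipartite
begin

text \<open>Here \<open>a\<close> and \<open>b\<close> are the total multiplicities on
  \<open>U\<close> and \<open>V\<close>. The rarest pair on each side gives one direction, balanced
  multiplicities on both sides the other.\<close>

lemma robust_size_iff:
  "(\<exists>S. robust_power_dominating G k S \<and> size S = m) \<longleftrightarrow>
   (\<exists>a b. a + b = m \<and> k < b + max_two_smallest n a \<and> k < a + max_two_smallest n b)"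
proof
  interpret swap: balanced_bipartite G V U n by (rule swap)
  assume "\<exists>S. robust_power_dominating G k S \<and> size S = m"
  then obtain S where S: "robust_power_dominating G k S" "size S = m" by blast
  obtain x y where xy: "x \<in> U" "y \<in> U" "x \<noteq> y"
    "count S x + count S y \<le> max_two_smallest n (sum (count S) U)"
    using exists_two_small_values[OF card_U n_ge_2] by metis
  obtain x' y' where xy': "x' \<in> V" "y' \<in> V" "x' \<noteq> y'"
    "count S x' + count S y' \<le> max_two_smallest n (sum (count S) V)"
    using exists_two_small_values[OF card_V n_ge_2] by metis
  have "k < sum (count S) V + max_two_smallest n (sum (count S) U)"
    using robust_imp_multiplicities[OF S(1) xy(1-3)] xy(4) by linarith
  moreover have "k < sum (count S) U + max_two_smallest n (sum (count S) V)"
    using swap.robust_imp_multiplicities[OF S(1) xy'(1-3)] xy'(4) by linarith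
  moreover have "sum (count S) U + sum (count S) V = m"
    using S size_eq_sums by (simp add: robust_power_dominating_def)
  ultimately show "\<exists>a b. a + b = m \<and> k < b + max_two_smallest n a \<and> k < a + max_two_smallest n b"
    by blast
next
  assume "\<exists>a b. a + b = m \<and> k < b + max_two_smallest n a \<and> k < a + max_two_smallest n b"
  then obtain a b where ab: "a + b = m" "k < b + max_two_smallest n a" "k < a + max_two_smallest n b"
    by blast
  obtain c :: "'a \<Rightarrow> nat" where c: "sum c U = a"
    "\<And>x y. x \<in> U \<Longrightarrow> y \<in> U \<Longrightarrow> x \<noteq> y \<Longrightarrow> max_two_smallest n a \<le> c x + c y"
    using exists_balanced_distribution[OF card_U n_ge_2] by blast
  obtain d :: "'a \<Rightarrow> nat" where d: "sum d V = b"
    "\<And>x y. x \<in> V \<Longrightarrow> y \<in> V \<Longrightarrow> x \<noteq> y \<Longrightarrow> max_two_smallest n b \<le> d x + d y"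
    using exists_balanced_distribution[OF card_V n_ge_2] by blast
  define S where "S = (\<Sum>z\<in>U. replicate_mset (c z) z) + (\<Sum>z\<in>V. replicate_mset (d z) z)"
  have count: "count S z = (if z \<in> U then c z else 0) + (if z \<in> V then d z else 0)" for z
    using finite_U finite_V by (simp add: S_def count_sum)
  have count_U: "count S z = c z" if "z \<in> U" for z using that disjoint by (auto simp: count)
  have count_V: "count S z = d z" if "z \<in> V" for z using that disjoint by (auto simp: count)
  have sums: "sum (count S) U = a" "sum (count S) V = b"
    using c(1) d(1) count_U count_V by simp_all
  have sub: "set_mset S \<subseteq> verts G"
  proof
    fix z assume "z \<in># S"
    then have "count S z > 0" by simp
    then show "z \<in> verts G" by (auto simp: count verts_eq split: if_splits)
  qed
  have "robust_power_dominating G k S"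
  proof (rule robust_power_dominatingI[OF sub])
    fix x y assume "x \<in> U" "y \<in> U" "x \<noteq> y"
    then show "k < sum (count S) V + count S x + count S y"
      using c(2)[of x y] ab(2) by (simp add: sums count_U)
  next
    fix x y assume "x \<in> V" "y \<in> V" "x \<noteq> y"
    then show "k < sum (count S) U + count S x + count S y"
      using d(2)[of x y] ab(3) by (simp add: sums count_V)
  qed
  moreover have "size S = m" using size_eq_sums[OF sub] sums ab(1) by simp
  ultimately show "\<exists>S. robust_power_dominating G k S \<and> size S = m" by blast
qed

end

section \<open>Minimising the total size\<close>

text \<open>The value \<open>?top\<close> is the first total at which
  \<open>max_two_smallest\<close> exceeds \<open>2 * q\<close>. If both totals stay below it, each
  must be at least \<open>q * n + i + 1\<close>, which gives the first argument of
  \<open>min\<close>; otherwise \<open>large\<close> gives the second.\<close>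

lemma size_lower_bound:
  assumes n: "n \<ge> 4" and k: "k = q * (n + 2) + i"
    and "k < b + max_two_smallest n a" "k < a + max_two_smallest n b"
  shows "2 * (q * n) + i + 1 + min (i + 1) (n - 2) \<le> a + b"
proof -
  let ?top = "q * n + (n - 1)"
  have k': "k = q * n + 2 * q + i" using k by (simp add: algebra_simps)
  have top: "max_two_smallest n ?top = 2 * q + 1" using n by (subst max_two_smallest_eq) auto
  \<comment> \<open>Each unit of \<open>y\<close> beyond \<open>?top\<close> gains at most one in
    the inequality, so it saves at most one unit of \<open>x\<close> and the sum does not
    drop.\<close>
  have large: "2 * (q * n) + i + n - 1 \<le> x + y" if y: "?top \<le> y" "k < x + max_two_smallest n y" for x y
  proof -
    obtain s where s: "y = ?top + s" using le_Suc_ex[OF y(1)] by blast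
    have "max_two_smallest n y \<le> 2 * q + 1 + s"
      using max_two_smallest_add_le[of n ?top s] n by (simp only: top s)
    then show ?thesis using y(2) k' s n by linarith
  qed
  consider "?top \<le> a" | "?top \<le> b" | "a < ?top" "b < ?top" by linarith
  then show ?thesis
  proof cases
    case 1
    then show ?thesis using large[OF _ assms(3)] n by linarith
  next
    case 2
    then show ?thesis using large[OF _ assms(4)] n by linarith
  next
    case 3
    have "max_two_smallest n (q * n + (n - 2)) = 2 * q"
      using n by (subst max_two_smallest_eq) auto
    moreover have "a \<le> q * n + (n - 2)" "b \<le> q * n + (n - 2)" using 3 n by auto
    ultimately have "max_two_smallest n a \<le> 2 * q" "max_two_smallest n b \<le> 2 * q"
      using max_two_smallest_mono[of _ "q * n + (n - 2)" n] by simp_all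
    then have "q * n + i + 1 \<le> b" "q * n + i + 1 \<le> a"
      using assms(3,4) k' by linarith+
    then show ?thesis by linarith
  qed
qed

text \<open>For \<open>i\<close> up to \<open>n - 3\<close> both totals are
  \<open>q * n + (i + 1)\<close>. At \<open>i = n - 2\<close> they are
  \<open>q * n + (n - 1)\<close> and \<open>q * n + (n - 2)\<close>, and each further step of
  \<open>i\<close> adds one unit to one of them until both equal \<open>q * n + n\<close>.\<close>

lemma size_attained:
  assumes n: "n \<ge> 4" and k: "k = q * (n + 2) + i" "i < n + 2"
  shows "\<exists>a b. a + b = 2 * (q * n) + i + 1 + min (i + 1) (n - 2) \<and>
    k < b + max_two_smallest n a \<and> k < a + max_two_smallest n b"
proof -
  have k': "k = q * n + 2 * q + i" using k(1) by (simp add: algebra_simps)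
  have small: "max_two_smallest n (q * n + r) = 2 * q" if "r + 1 < n" for r
    using that by (subst max_two_smallest_eq) auto
  have m1: "max_two_smallest n (q * n + (n - 1)) = 2 * q + 1"
    using n by (subst max_two_smallest_eq) auto
  have m0: "max_two_smallest n (q * n + n) = 2 * q + 2"
    using n max_two_smallest_eq[of 0 n "q + 1"] by (simp add: add.commute)
  consider "i + 1 \<le> n - 2" | "i = n - 2" | "i = n - 1" | "i = n" | "i = n + 1"
    using k(2) by linarith
  then show ?thesis
  proof cases
    case 1
    then show ?thesis using small[of "i + 1"] n k'
      by (intro exI[of _ "q * n + (i + 1)"]) auto
  next
    case 2
    then show ?thesis using small[of "n - 2"] m1 n k'
      by (intro exI[of _ "q * n + (n - 1)"] exI[of _ "q * n + (n - 2)"]) auto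
  next
    case 3
    then show ?thesis using m1 n k'
      by (intro exI[of _ "q * n + (n - 1)"]) auto
  next
    case 4
    then show ?thesis using m1 m0 n k'
      by (intro exI[of _ "q * n + (n - 1)"] exI[of _ "q * n + n"]) auto
  next
    case 5
    then show ?thesis using m0 n k'
      by (intro exI[of _ "q * n + n"]) auto
  qed
qed

text \<open>A single formula for both cases: each full period \<open>n + 2\<close> of
  \<open>k\<close> costs \<open>2 * n\<close>, and \<open>min\<close> switches between
  \<open>i = n - 3\<close> and \<open>i = n - 2\<close>.\<close>

lemma robust_pd_number_complete_bipartite:
  assumes "n \<ge> 4" "K\<^bsub>n,n\<^esub> G" "k = q * (n + 2) + i" "i < n + 2"
  shows "robust_pd_number G k = 2 * (q * n) + i + 1 + min (i + 1) (n - 2)"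
proof -
  obtain U V where "verts G = U \<union> V" "U \<inter> V = {}" "card U = n" "card V = n"
    "arcs_ends G = U \<times> V \<union> V \<times> U"
    using assms(2) unfolding complete_bipartite_digraph_def by blast
  then interpret balanced_bipartite G U V n
    using assms(1) by unfold_locales auto
  show ?thesis
    unfolding robust_pd_number_def robust_size_iff
    using size_attained[OF assms(1,3,4)] size_lower_bound[OF assms(1,3)]
    by (intro Least_equality) auto
qed

theorem corollary4p7:
  fixes G :: "('a, 'b) pre_digraph" and n k :: nat
  assumes "n \<ge> 4" and "k \<ge> 1" and "K\<^bsub>n,n\<^esub> G"
  shows "int (robust_pd_number G k) =
    (if \<exists>i \<le> n - 3. [k = i] (mod (n + 2))
     then 2 * (int k + 1) - 4 * \<lfloor>real k / real (n + 2)\<rfloor>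
     else int k + int n - 1 + (int n - 2) * \<lfloor>real k / real (n + 2)\<rfloor>)"
proof -
  define q i where "q = k div (n + 2)" and "i = k mod (n + 2)"
  have k: "k = q * (n + 2) + i" and i: "i < n + 2" by (simp_all only: q_def i_def div_mult_mod_eq) simp
  have floor: "\<lfloor>real k / real (n + 2)\<rfloor> = int q"
    unfolding q_def by (rule floor_divide_of_nat_eq)
  have cong: "(\<exists>j \<le> n - 3. [k = j] (mod (n + 2))) \<longleftrightarrow> i \<le> n - 3"
  proof
    assume "\<exists>j \<le> n - 3. [k = j] (mod (n + 2))"
    then obtain j where j: "j \<le> n - 3" "k mod (n + 2) = j mod (n + 2)" by (auto simp: cong_def)
    \<comment> \<open>Since \<open>j\<close> is below \<open>n + 2\<close>, it is its own
      residue.\<close>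
    then show "i \<le> n - 3" by (simp add: i_def)
  next
    assume "i \<le> n - 3"
    then show "\<exists>j \<le> n - 3. [k = j] (mod (n + 2))" by (auto simp: cong_def i_def)
  qed
  have number: "robust_pd_number G k = 2 * (q * n) + i + 1 + min (i + 1) (n - 2)"
    by (rule robust_pd_number_complete_bipartite[OF assms(1,3) k i])
  show ?thesis
  proof (cases "i \<le> n - 3")
    case True
    then have "min (i + 1) (n - 2) = i + 1" using assms(1) by simp
    \<comment> \<open>Both sides equal \<open>2 * q * n + 2 * (i + 1)\<close>.\<close>
    then show ?thesis unfolding floor cong number using True by (simp add: k algebra_simps)
  next
    case False
    then have "int (min (i + 1) (n - 2)) = int n - 2" using assms(1) by simp
    \<comment> \<open>Both sides equal \<open>2 * q * n + i + n - 1\<close>: the terms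
      \<open>2 * q\<close> from \<open>k\<close> and \<open>- 2 * q\<close> from the floor term
      cancel.\<close>
    then show ?thesis unfolding floor cong number using False by (simp add: k algebra_simps)
  qed
qed

end
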